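(* Let $a,b,r,s$ be nonzero real numbers. For every non-negative integer $i$, \[ \phi^{a,b}_{i}(x)=\left(\frac{a}{r}\right)^i \sum_{m=0}^{\lfloor i/2\rfloor}c_{i-2m}\,(-s)^m\binom{i}{m}\ {}_2F_1\!\left(-m,\,m-i;\,-i;\,\frac{b\,r^2}{a^2 s}\right)\psi^{r,s}_{i-2m}(x). \]
   Context: For nonzero reals $a,b$, the generalized Fibonacci polynomials are defined by $\phi^{a,b}_0(x)=1$, $\phi^{a,b}_1(x)=ax$, $\phi^{a,b}_j(x)=ax\,\phi^{a,b}_{j-1}(x)+b\,\phi^{a,b}_{j-2}(x)$ for $j\ge2$. For nonzero reals $r,s$, the generalized Lucas polynomials are defined by $\psi^{r,s}_0(x)=2$, $\psi^{r,s}_1(x)=rx$, $\psi^{r,s}_j(x)=rx\,\psi^{r,s}_{j-1}(x)+s\,\psi^{r,s}_{j-2}(x)$ for $j\ge2$. The constants are $c_0=\tfrac12$ and $c_j=1$ for $j\ge1$. For a non-negative integer $m$, ${}_2F_1(-m,\beta;\gamma;z)=\sum_{k=0}^{m}\frac{(-m)_k(\beta)_k}{(\gamma)_k}\frac{z^k}{k!}$, where $(u)_k=u(u+1)\cdots(u+k-1)$, $(u)_0=1$ (here $(\gamma)_k\ne0$ for all $0\le k\le m$). *)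

theory Defs
  imports Complex_Main "HOL-Computational_Algebra.Polynomial"
begin

fun gen_fib :: "real \<Rightarrow> real \<Rightarrow> nat \<Rightarrow> real poly" where
  "gen_fib a b 0 = 1"
| "gen_fib a b (Suc 0) = [:0, a:]"
| "gen_fib a b (Suc (Suc j)) = [:0, a:] * gen_fib a b (Suc j) + smult b (gen_fib a b j)"

fun gen_lucas :: "real \<Rightarrow> real \<Rightarrow> nat \<Rightarrow> real poly" where
  "gen_lucas r s 0 = 2"
| "gen_lucas r s (Suc 0) = [:0, r:]"
| "gen_lucas r s (Suc (Suc j)) = [:0, r:] * gen_lucas r s (Suc j) + smult s (gen_lucas r s j)"

definition lucas_const :: "nat \<Rightarrow> real" where
  "lucas_const j = (if j = 0 then 1 / 2 else 1)"

text \<open>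
  The terminating Gauss hypergeometric function \<open>\<^sub>2F\<^sub>1(-m, \<beta>; \<gamma>; z)\<close>, to be used only when
  \<open>pochhammer \<gamma> k \<noteq> 0\<close> for all \<open>k \<le> m\<close>; in particular \<open>\<gamma>\<close> may be an integer \<open>\<le> -m\<close>.
\<close>
definition hyp2F1_term :: "nat \<Rightarrow> real \<Rightarrow> real \<Rightarrow> real \<Rightarrow> real" where
  "hyp2F1_term m \<beta> \<gamma> z =
     (\<Sum>k=0..m. pochhammer (- real m) k * pochhammer \<beta> k / pochhammer \<gamma> k * (z ^ k / fact k))"

end

theory Submission
  imports Defs
begin

text \<open>
  Expand \<open>\<phi>\<^sub>i = \<Sum>\<^sub>k binom(i-k, k) b\<^sup>k (a x)\<^bsup>i-2k\<^esup>\<close> and substitute the inversion formula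
  \<open>(r x)\<^sup>n = \<Sum>\<^sub>j c\<^bsub>n-2j\<^esub> binom(n, j) (-s)\<^sup>j \<psi>\<^bsub>n-2j\<^esub>\<close>. The latter is the binomial theorem for
  \<open>r x = \<alpha> + \<beta>\<close>, \<open>-s = \<alpha> \<beta>\<close>, \<open>\<psi>\<^sub>n = \<alpha>\<^sup>n + \<beta>\<^sup>n\<close>, with the terms \<open>j\<close> and \<open>n - j\<close> paired. Collecting the
  coefficient of \<open>\<psi>\<^bsub>i-2m\<^esub>\<close> gives the terminating hypergeometric sum.
\<close>

lemma smult_sum_right: "smult c (\<Sum>i\<in>S. f i) = (\<Sum>i\<in>S. smult c (f i))"
  by (induction S rule: infinite_finite_induct) (simp_all add: smult_add_right)

text \<open>By induction along the recurrence: the coefficients \<open>(i - k) choose k\<close>,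
  shallow diagonals of Pascal's triangle, add up by Pascal's rule.\<close>

lemma gen_fib_expansion:
  "gen_fib a b i = (\<Sum>k\<le>i div 2. smult (real ((i - k) choose k) * b ^ k) ([:0, a:] ^ (i - 2 * k)))"
proof -
  define t where "t i k = smult (real ((i - k) choose k) * b ^ k) ([:0, a:] ^ (i - 2 * k))" for i k
  \<comment> \<open>These vanishing terms let the induction sum over all \<open>k \<le> i\<close>, a
    range free of parity cases.\<close>
  have t_zero: "t i k = 0" if "i < 2 * k" "k \<le> i" for i k
    using that by (simp add: t_def binomial_eq_0)
  have t_0: "[:0, a:] * t (Suc i) 0 = t (Suc (Suc i)) 0" for i
    by (simp add: t_def)
  have t_rec: "[:0, a:] * t (Suc i) (Suc k) + smult b (t i k) = t (Suc (Suc i)) (Suc k)"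
    if "k \<le> i" for i k
  proof -
    \<comment> \<open>Pascal's rule for \<open>Suc (i - k) choose Suc k\<close>; both sides carry
      the exponent \<open>i - 2 * k\<close>.\<close>
    have split: "t (Suc (Suc i)) (Suc k)
      = smult (real ((i - k) choose Suc k) * b ^ Suc k) ([:0, a:] ^ (i - 2 * k))
        + smult b (t i k)"
      using that by (simp add: t_def Suc_diff_le smult_add_left [symmetric] algebra_simps)
    have "[:0, a:] * t (Suc i) (Suc k)
      = smult (real ((i - k) choose Suc k) * b ^ Suc k) ([:0, a:] ^ (i - 2 * k))"
    \<comment> \<open>If \<open>2 * k \<ge> i\<close>, the exponent \<open>Suc i - 2 * Suc k\<close>
      truncates to 0 and the power law may fail, but then the binomial coefficient is 0.\<close>
    proof (cases "2 * k < i")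
      case True
      then have "i - 2 * k = Suc (Suc i - 2 * Suc k)" by simp
      then have "[:0, a:] ^ (i - 2 * k) = [:0, a:] * [:0, a:] ^ (Suc i - 2 * Suc k)"
        by (metis power_Suc)
      then show ?thesis
        by (simp only: t_def diff_Suc_Suc mult_smult_right)
    next
      case False
      then have "(i - k) choose Suc k = 0" by (intro binomial_eq_0) simp
      then show ?thesis by (simp add: t_def)
    qed
    with split show ?thesis by simp
  qed
  have "gen_fib a b i = (\<Sum>k\<le>i. t i k)"
  proof (induction i rule: gen_fib.induct [of "\<lambda>_ _ i. gen_fib a b i = (\<Sum>k\<le>i. t i k)" a b])
    case (3 _ _ i)
    have last: "t (Suc (Suc i)) (Suc (Suc i)) = 0" by (rule t_zero) auto
    have "gen_fib a b (Suc (Suc i))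
      = [:0, a:] * (\<Sum>k\<le>Suc i. t (Suc i) k) + smult b (\<Sum>k\<le>i. t i k)"
      using 3 by simp
    also have "\<dots> = [:0, a:] * t (Suc i) 0
      + (\<Sum>k\<le>i. [:0, a:] * t (Suc i) (Suc k) + smult b (t i k))"
      by (simp only: sum.atMost_Suc_shift distrib_left sum.distrib sum_distrib_left smult_sum_right
          add.assoc)
    also have "\<dots> = t (Suc (Suc i)) 0 + (\<Sum>k\<le>i. t (Suc (Suc i)) (Suc k))"
      unfolding t_0 by (rule arg_cong [OF sum.cong]) (simp, rule t_rec, simp)
    also have "\<dots> = (\<Sum>k\<le>Suc i. t (Suc (Suc i)) k)"
      by (simp only: sum.atMost_Suc_shift)
    also have "\<dots> = (\<Sum>k\<le>Suc (Suc i). t (Suc (Suc i)) k)"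
      using last by simp
    finally show ?case .
  qed (simp_all add: t_def)
  also have "\<dots> = (\<Sum>k\<le>i div 2. t i k)"
    by (rule sum.mono_neutral_right) (auto intro!: t_zero)
  finally show ?thesis by (simp only: t_def)
qed

text \<open>Multiplication by \<open>x\<close> acts as the sum of two commuting index shifts, so the
  binomial theorem applies without naming the roots \<alpha> and \<beta>.\<close>

lemma power_times_eq_binomial_sum:
  fixes W :: "nat \<Rightarrow> nat \<Rightarrow> 'a::comm_semiring_1"
  assumes "\<And>p q. x * W p q = W (Suc p) q + W p (Suc q)"
  shows "x ^ n * W p q = (\<Sum>j\<le>n. of_nat (n choose j) * W (p + j) (q + (n - j)))"
proof (induction n arbitrary: p q)
  case (Suc n)
  have "x ^ Suc n * W p q = x ^ n * W p (Suc q) + x ^ n * W (Suc p) q"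
    by (simp only: power_Suc2 mult.assoc assms distrib_left add.commute)
  also have "\<dots> = (\<Sum>j\<le>n. of_nat (n choose j) * W (p + j) (q + (Suc n - j)))
      + (\<Sum>j\<le>n. of_nat (n choose j) * W (p + Suc j) (q + (n - j)))"
    by (simp add: Suc.IH Suc_diff_le)
  \<comment> \<open>The added term has coefficient 0; splitting off \<open>j = 0\<close> then aligns
    both sums for Pascal's rule.\<close>
  also have "(\<Sum>j\<le>n. of_nat (n choose j) * W (p + j) (q + (Suc n - j)))
      = (\<Sum>j\<le>Suc n. of_nat (n choose j) * W (p + j) (q + (Suc n - j)))"
    by (simp add: binomial_eq_0)
  also have "\<dots> = W p (q + Suc n)
      + (\<Sum>j\<le>n. of_nat (n choose Suc j) * W (p + Suc j) (q + (n - j)))"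
    by (simp add: sum.atMost_Suc_shift del: sum.atMost_Suc)
  finally show ?case
    by (simp add: sum.atMost_Suc_shift sum.distrib algebra_simps del: sum.atMost_Suc)
qed simp

text \<open>The indices \<open>j\<close> and \<open>n - j\<close> pair up; for even \<open>n\<close>
  the middle term is unpaired, and \<open>lucas_const 0 = 1/2\<close> offsets the factor 2.\<close>

lemma sum_symmetric_fold:
  fixes f :: "nat \<Rightarrow> real poly"
  assumes "\<And>j. j \<le> n \<Longrightarrow> f (n - j) = f j"
  shows "(\<Sum>j\<le>n. f j) = 2 * (\<Sum>j\<le>n div 2. smult (lucas_const (n - 2 * j)) (f j))"
proof -
  \<comment> \<open>\<open>g\<close> moves the weight of each pair to its smaller index and keeps a
    middle term once, so \<open>f\<close> and \<open>g\<close> have equal sums over each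
    pair.\<close>
  define g where "g j = (if 2 * j \<le> n then smult (2 * lucas_const (n - 2 * j)) (f j) else 0)" for j
  have two: "smult 2 p = p + p" for p :: "real poly"
    using smult_add_left [of 1 1 p] by simp
  have flip: "(\<Sum>j\<le>n. h (n - j)) = (\<Sum>j\<le>n. h j)" for h :: "nat \<Rightarrow> real poly"
    by (rule sum.reindex_bij_witness [of _ "\<lambda>j. n - j" "\<lambda>j. n - j"]) auto
  have "f j + f (n - j) = g j + g (n - j)" if "j \<le> n" for j
  proof -
    consider "2 * j < n" | "n = 2 * j" | "n < 2 * j" by linarith
    then show ?thesis
      using that assms [of j] by cases (auto simp: g_def lucas_const_def two)
  qed
  then have "(\<Sum>j\<le>n. f j + f (n - j)) = (\<Sum>j\<le>n. g j + g (n - j))" by (intro sum.cong) auto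
  then have "smult 2 (\<Sum>j\<le>n. f j) = smult 2 (\<Sum>j\<le>n. g j)"
    by (simp add: sum.distrib flip two)
  then have "(\<Sum>j\<le>n. f j) = (\<Sum>j\<le>n. g j)"
    by (rule smult_cancel [rotated]) simp
  also have "\<dots> = (\<Sum>j\<le>n div 2. g j)"
    by (rule sum.mono_neutral_right) (auto simp: g_def)
  also have "\<dots> = (\<Sum>j\<le>n div 2. 2 * smult (lucas_const (n - 2 * j)) (f j))"
    by (intro sum.cong) (auto simp: g_def numeral_poly mult.commute)
  finally show ?thesis by (simp add: sum_distrib_left)
qed

lemma power_eq_sum_gen_lucas:
  "[:0, r:] ^ n = (\<Sum>j\<le>n div 2. smult (lucas_const (n - 2 * j) * (- s) ^ j * real (n choose j))
     (gen_lucas r s (n - 2 * j)))"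
proof -
  \<comment> \<open>\<open>W p q\<close> stands for \<open>\<alpha>\<^sup>p \<beta>\<^sup>q + \<alpha>\<^sup>q \<beta>\<^sup>p\<close>.\<close>
  define W where "W p q = smult ((- s) ^ min p q) (gen_lucas r s (max p q - min p q))" for p q
  have W_sym: "W p q = W q p" for p q by (simp add: W_def min.commute max.commute)
  \<comment> \<open>Raising the smaller index gives a factor \<open>- s\<close> and shortens the
    gap; raising the larger one widens it. This is the Lucas recurrence.\<close>
  have rec_less: "[:0, r:] * W p q = W (Suc p) q + W p (Suc q)" if "p < q" for p q
  proof -
    from that obtain d where q: "q = Suc (p + d)" using less_iff_Suc_add by auto
    have "W p q = smult ((- s) ^ p) (gen_lucas r s (Suc d))" by (simp add: W_def q)
    moreover have "W (Suc p) q = smult ((- s) ^ Suc p) (gen_lucas r s d)" by (simp add: W_def q)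
    moreover have "W p (Suc q) = smult ((- s) ^ p) (gen_lucas r s (Suc (Suc d)))"
      by (simp add: W_def q Suc_diff_le)
    ultimately show ?thesis
      by (simp add: smult_add_right algebra_simps)
  qed
  \<comment> \<open>On the diagonal both shifts give the same polynomial, matched by the initial
    value 2 of \<open>gen_lucas\<close>.\<close>
  have rec_eq: "[:0, r:] * W p p = W (Suc p) p + W p (Suc p)" for p
    by (simp add: W_def algebra_simps numeral_poly flip: smult_add_left)
  have W_rec: "[:0, r:] * W p q = W (Suc p) q + W p (Suc q)" for p q
    using rec_less [of p q] rec_less [of q p] rec_eq [of p]
    by (cases p q rule: linorder_cases) (simp_all only: W_sym add.commute)
  define f where "f j = smult (real (n choose j)) (W j (n - j))" for j
  \<comment> \<open>The factor 2 is \<open>W 0 0\<close>; it cancels against the one from folding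
    the sum.\<close>
  have "2 * [:0, r:] ^ n = (\<Sum>j\<le>n. f j)"
    using power_times_eq_binomial_sum [of "[:0, r:]" W n 0 0, OF W_rec]
    by (simp add: W_def f_def of_nat_poly mult.commute)
  also have "\<dots> = 2 * (\<Sum>j\<le>n div 2. smult (lucas_const (n - 2 * j)) (f j))"
    by (rule sum_symmetric_fold) (simp add: f_def W_sym binomial_symmetric [symmetric])
  finally have "[:0, r:] ^ n = (\<Sum>j\<le>n div 2. smult (lucas_const (n - 2 * j)) (f j))" by simp
  also have "\<dots> = (\<Sum>j\<le>n div 2. smult (lucas_const (n - 2 * j) * (- s) ^ j * real (n choose j))
     (gen_lucas r s (n - 2 * j)))"
  proof (intro sum.cong refl)
    fix j assume "j \<in> {..n div 2}"
    then have "min j (n - j) = j" "max j (n - j) - min j (n - j) = n - 2 * j" by auto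
    then show "smult (lucas_const (n - 2 * j)) (f j)
      = smult (lucas_const (n - 2 * j) * (- s) ^ j * real (n choose j)) (gen_lucas r s (n - 2 * j))"
      by (simp only: f_def W_def smult_smult mult_ac)
  qed
  finally show ?thesis .
qed

lemma pochhammer_minus_of_nat:
  assumes "k \<le> n"
  shows "pochhammer (- real n) k = (- 1) ^ k * fact n / fact (n - k)"
proof -
  have "real n - real k + 1 = 1 + real (n - k)" using assms by simp
  then have "fact n = fact (n - k) * pochhammer (real n - real k + 1) k"
    using pochhammer_product [of "n - k" n "1 :: real"] assms by (simp only: pochhammer_fact) simp
  then show ?thesis by (simp add: pochhammer_minus)
qed

text \<open>Holds term by term: the Pochhammer symbols become factorial quotients, and their three
  signs combine to \<open>(- 1) ^ k\<close>.\<close>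

lemma choose_times_hyp2F1_term:
  assumes "2 * m \<le> i"
  shows "real (i choose m) * hyp2F1_term m (real m - real i) (- real i) z =
    (\<Sum>k\<le>m. real ((i - k) choose k) * real ((i - 2 * k) choose (m - k)) * (- z) ^ k)"
  unfolding hyp2F1_term_def sum_distrib_left atLeast0AtMost
proof (intro sum.cong refl)
  fix k assume "k \<in> {..m}"
  then have k: "k \<le> m" "k \<le> i - m" "k \<le> i" "m \<le> i" "2 * k \<le> i" using assms by auto
  have beta: "real m - real i = - real (i - m)" using k by simp
  have diffs: "i - k - k = i - 2 * k" "i - 2 * k - (m - k) = i - m - k" using k by auto
  have choose: "real (i choose m) = fact i / (fact m * fact (i - m))"
    "real ((i - k) choose k) = fact (i - k) / (fact k * fact (i - 2 * k))"
    "real ((i - 2 * k) choose (m - k)) = fact (i - 2 * k) / (fact (m - k) * fact (i - m - k))"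
    using k by (simp_all only: binomial_fact diffs diff_le_mono le_diff_conv2)
  have sign: "(- z) ^ k = (- 1) ^ k * z ^ k" by (simp flip: power_mult_distrib)
  show "real (i choose m) * (pochhammer (- real m) k * pochhammer (real m - real i) k
        / pochhammer (- real i) k * (z ^ k / fact k))
    = real ((i - k) choose k) * real ((i - 2 * k) choose (m - k)) * (- z) ^ k"
    unfolding beta choose sign
    by (simp only: k pochhammer_minus_of_nat, simp) (simp only: mult_ac)
qed

theorem theorem1:
  fixes a b r s :: real and i :: nat
  assumes "a \<noteq> 0" and "b \<noteq> 0" and "r \<noteq> 0" and "s \<noteq> 0"
  shows "gen_fib a b i =
    smult ((a / r) ^ i)
      (\<Sum>m=0..i div 2.
         smult (lucas_const (i - 2 * m) * (- s) ^ m * real (i choose m)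
                * hyp2F1_term m (real m - real i) (- real i) (b * r\<^sup>2 / (a\<^sup>2 * s)))
               (gen_lucas r s (i - 2 * m)))"
proof -
  define z where "z = b * r\<^sup>2 / (a\<^sup>2 * s)"
  \<comment> \<open>\<open>T k j\<close> is the contribution of the \<open>j\<close>-th inversion
    term to the \<open>k\<close>-th term of the expansion. As
    \<open>(a / r)\<^sup>2 * (s * z) = b\<close>, the factor \<open>b ^ k\<close> is absorbed so
    that \<open>- s\<close> gets the exponent \<open>k + j\<close>.\<close>
  define T where "T k j = smult ((a / r) ^ i * real ((i - k) choose k)
      * real ((i - 2 * k) choose j) * (- s) ^ (k + j) * (- z) ^ k * lucas_const (i - 2 * (k + j)))
      (gen_lucas r s (i - 2 * (k + j)))" for k j
  have fib_term: "smult (real ((i - k) choose k) * b ^ k) ([:0, a:] ^ (i - 2 * k))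
      = (\<Sum>j\<le>i div 2 - k. T k j)" if "k \<le> i div 2" for k
  proof -
    have i: "i = (i - 2 * k) + 2 * k" and half: "(i - 2 * k) div 2 = i div 2 - k"
      using that by auto
    have "(a / r) ^ i * ((- s) ^ k * (- z) ^ k) = (a / r) ^ (i - 2 * k) * ((a / r)\<^sup>2 * (s * z)) ^ k"
      by (subst i) (simp add: power_add power_mult power_mult_distrib flip: power_mult_distrib)
    also have "(a / r)\<^sup>2 * (s * z) = b"
      using assms by (simp add: z_def field_simps)
    finally have coeff: "(a / r) ^ i * ((- s) ^ k * (- z) ^ k) = (a / r) ^ (i - 2 * k) * b ^ k" .
    have "[:0, a:] = smult (a / r) [:0, r:]" using assms by simp
    then have "[:0, a:] ^ (i - 2 * k) = smult ((a / r) ^ (i - 2 * k)) ([:0, r:] ^ (i - 2 * k))"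
      by (simp only: smult_power)
    then have "smult (real ((i - k) choose k) * b ^ k) ([:0, a:] ^ (i - 2 * k))
      = smult (real ((i - k) choose k) * ((a / r) ^ i * ((- s) ^ k * (- z) ^ k)))
          ([:0, r:] ^ (i - 2 * k))"
      by (simp only: coeff smult_smult mult.assoc mult.left_commute [of "b ^ k"] mult.commute [of "b ^ k"])
    also have "\<dots> = (\<Sum>j\<le>i div 2 - k. T k j)"
      unfolding power_eq_sum_gen_lucas [of r "i - 2 * k" s] half smult_sum_right smult_smult
      by (intro sum.cong refl) (simp add: T_def power_add mult_ac add_mult_distrib2)
    finally show ?thesis .
  qed
  \<comment> \<open>The diagonal \<open>k + j = m\<close> collects everything that multiplies
    \<open>gen_lucas r s (i - 2 * m)\<close>.\<close>
  have lucas_term: "smult ((a / r) ^ i) (smult (lucas_const (i - 2 * m) * (- s) ^ m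
      * real (i choose m) * hyp2F1_term m (real m - real i) (- real i) z) (gen_lucas r s (i - 2 * m)))
      = (\<Sum>k\<le>m. T k (m - k))" if "m \<le> i div 2" for m
  proof -
    have "2 * m \<le> i" using that by simp
    then show ?thesis
      by (simp only: mult.assoc choose_times_hyp2F1_term smult_smult sum_distrib_left smult_sum
          smult_sum_right)
        (intro sum.cong refl, simp add: T_def mult_ac)
  qed
  have "gen_fib a b i = (\<Sum>k\<le>i div 2. \<Sum>j\<le>i div 2 - k. T k j)"
    by (simp add: gen_fib_expansion fib_term)
  also have "\<dots> = (\<Sum>(k, j)\<in>(SIGMA k:{..i div 2}. {..i div 2 - k}). T k j)"
    by (simp add: sum.Sigma)
  also have "(SIGMA k:{..i div 2}. {..i div 2 - k}) = {(k, j). k + j \<le> i div 2}"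
    by auto
  also have "(\<Sum>(k, j)\<in>{(k, j). k + j \<le> i div 2}. T k j) = (\<Sum>m\<le>i div 2. \<Sum>k\<le>m. T k (m - k))"
    by (rule sum.triangle_reindex_eq)
  finally show ?thesis
    by (simp only: z_def [symmetric] smult_sum_right atLeast0AtMost) (simp add: lucas_term del: smult_smult)
qed

end
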